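(* Let $G=(V,E)$ be a finite simple chordal graph. Then for every integer $k\ge 2$, the total $k$-cut complex $\Delta_k^t(G)$ is vertex decomposable, and therefore shellable.
   Context: A graph is chordal if it contains no induced cycle with more than 3 vertices. A set $S\subseteq V$ is independent if no two vertices of $S$ form an edge. For $k\ge 1$, the total $k$-cut complex $\Delta_k^t(G)$ is the simplicial complex whose facets are the sets $V\setminus S$ with $S$ an independent set of $G$ of size $k$; equivalently $\sigma\subseteq V$ is a face iff $V\setminus\sigma$ contains an independent set of size $k$. If $G$ has no independent set of size $k$, $\Delta_k^t(G)$ is the void complex (no faces at all, not even $\emptyset$). A $d$-dimensional simplicial complex $\Delta$ is vertex decomposable if either $\Delta$ is a simplex, or there is a vertex $v$ such that $\mathrm{lk}_\Delta v=\{\tau\in\Delta: v\notin\tau,\ \tau\cup\{v\}\in\Delta\}$ and $\mathrm{del}_\Delta v=\{\tau\in\Delta: v\notin\tau\}$ are both vertex decomposable and $\mathrm{del}_\Delta v$ is pure of dimension $d$. By convention the void complex is considered vertex decomposable and shellable. *)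

theory Defs
  imports Main "HOL-Library.Ramsey"
begin

text \<open>A graph is a vertex set together with a set of two-element subsets of it; independence is
  the library's \<^const>\<open>indep\<close>.  The cycle below is given by its cyclic list of vertices:
  the edges of the graph among these vertices are exactly those joining cyclically consecutive ones.\<close>

definition induced_cycle :: "'a set \<Rightarrow> 'a set set \<Rightarrow> 'a list \<Rightarrow> bool" where
  "induced_cycle V E c \<longleftrightarrow>
     length c \<ge> 3 \<and> distinct c \<and> set c \<subseteq> V \<and>
     (\<forall>i < length c. \<forall>j < length c.
        {c ! i, c ! j} \<in> E \<longleftrightarrow> j = Suc i mod length c \<or> i = Suc j mod length c)"

definition chordal_graph :: "'a set \<Rightarrow> 'a set set \<Rightarrow> bool" where
  "chordal_graph V E \<longleftrightarrow> \<not> (\<exists>c. induced_cycle V E c \<and> length c > 3)"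

text \<open>Finite abstract simplicial complexes are represented by their sets of faces.  The void
  complex \<open>{}\<close> is allowed, and it differs from the complex \<open>{{}}\<close>, which has dimension -1.\<close>

definition is_complex :: "'a set set \<Rightarrow> bool" where
  "is_complex \<Delta> \<longleftrightarrow> finite (\<Union>\<Delta>) \<and> (\<forall>\<sigma>\<in>\<Delta>. \<forall>\<tau>. \<tau> \<subseteq> \<sigma> \<longrightarrow> \<tau> \<in> \<Delta>)"

definition complex_facets :: "'a set set \<Rightarrow> 'a set set" where
  "complex_facets \<Delta> = {F \<in> \<Delta>. \<forall>\<sigma>\<in>\<Delta>. F \<subseteq> \<sigma> \<longrightarrow> \<sigma> = F}"

definition face_dim :: "'a set \<Rightarrow> int" where
  "face_dim \<sigma> = int (card \<sigma>) - 1"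

text \<open>The dimension is used for non-void complexes only.\<close>

definition complex_dim :: "'a set set \<Rightarrow> int" where
  "complex_dim \<Delta> = Max (face_dim ` \<Delta>)"

definition pure_of_dim :: "'a set set \<Rightarrow> int \<Rightarrow> bool" where
  "pure_of_dim \<Delta> d \<longleftrightarrow> (\<forall>F \<in> complex_facets \<Delta>. face_dim F = d)"

definition complex_link :: "'a set set \<Rightarrow> 'a \<Rightarrow> 'a set set" where
  "complex_link \<Delta> v = {\<tau> \<in> \<Delta>. v \<notin> \<tau> \<and> \<tau> \<union> {v} \<in> \<Delta>}"

definition complex_del :: "'a set set \<Rightarrow> 'a \<Rightarrow> 'a set set" where
  "complex_del \<Delta> v = {\<tau> \<in> \<Delta>. v \<notin> \<tau>}"

text \<open>A simplex is the set of all subsets of a finite set, which may be empty.\<close>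

inductive vertex_decomposable :: "'a set set \<Rightarrow> bool" where
  void: "vertex_decomposable {}"
| simplex: "finite A \<Longrightarrow> vertex_decomposable (Pow A)"
| shed: "\<lbrakk>is_complex \<Delta>; {v} \<in> \<Delta>;
    vertex_decomposable (complex_link \<Delta> v);
    vertex_decomposable (complex_del \<Delta> v);
    pure_of_dim (complex_del \<Delta> v) (complex_dim \<Delta>)\<rbrakk>
    \<Longrightarrow> vertex_decomposable \<Delta>"

text \<open>A shelling lists the facets so that each facet meets the complex generated by its
  predecessors in a pure complex of codimension one.  The empty list is a shelling of the void
  complex.\<close>

definition shelling :: "'a set set \<Rightarrow> 'a set list \<Rightarrow> bool" where
  "shelling \<Delta> Fs \<longleftrightarrow>
     distinct Fs \<and> set Fs = complex_facets \<Delta> \<and>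
     (\<forall>j < length Fs. 0 < j \<longrightarrow>
        pure_of_dim ((\<Union>i<j. Pow (Fs ! i)) \<inter> Pow (Fs ! j)) (face_dim (Fs ! j) - 1))"

definition shellable :: "'a set set \<Rightarrow> bool" where
  "shellable \<Delta> \<longleftrightarrow> is_complex \<Delta> \<and> (\<exists>Fs. shelling \<Delta> Fs)"

definition total_cut_complex :: "'a set \<Rightarrow> 'a set set \<Rightarrow> nat \<Rightarrow> 'a set set" where
  "total_cut_complex V E k =
     {\<sigma>. \<sigma> \<subseteq> V \<and> (\<exists>S. S \<subseteq> V - \<sigma> \<and> indep S E \<and> card S = k)}"

lemma is_complex_total_cut_complex:
  assumes "finite V"
  shows "is_complex (total_cut_complex V E k)"
proof -
  have "\<Union>(total_cut_complex V E k) \<subseteq> V"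
    by (auto simp: total_cut_complex_def)
  then have "finite (\<Union>(total_cut_complex V E k))"
    using assms finite_subset by blast
  moreover have "\<tau> \<in> total_cut_complex V E k"
    if "\<sigma> \<in> total_cut_complex V E k" "\<tau> \<subseteq> \<sigma>" for \<sigma> \<tau>
    using that unfolding total_cut_complex_def by blast
  ultimately show ?thesis
    unfolding is_complex_def by blast
qed

lemma complex_facets_total_cut_complex:
  assumes "finite V"
  shows "complex_facets (total_cut_complex V E k) =
    {V - S | S. S \<subseteq> V \<and> indep S E \<and> card S = k}"
proof (intro equalityI subsetI)
  fix F assume F: "F \<in> complex_facets (total_cut_complex V E k)"
  then obtain S where S: "F \<subseteq> V" "S \<subseteq> V - F" "indep S E" "card S = k"
    by (auto simp: complex_facets_def total_cut_complex_def)
  have "V - S \<in> total_cut_complex V E k"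
    using S unfolding total_cut_complex_def by blast
  moreover have "F \<subseteq> V - S" using S by blast
  ultimately have "V - S = F"
    using F by (auto simp: complex_facets_def)
  then show "F \<in> {V - S | S. S \<subseteq> V \<and> indep S E \<and> card S = k}"
    using S by blast
next
  fix F assume "F \<in> {V - S | S. S \<subseteq> V \<and> indep S E \<and> card S = k}"
  then obtain S where S: "F = V - S" "S \<subseteq> V" "indep S E" "card S = k" by blast
  have "F \<in> total_cut_complex V E k"
    using S unfolding total_cut_complex_def by blast
  moreover have "\<sigma> = F" if \<sigma>: "\<sigma> \<in> total_cut_complex V E k" "F \<subseteq> \<sigma>" for \<sigma>
  proof -
    obtain T where T: "\<sigma> \<subseteq> V" "T \<subseteq> V - \<sigma>" "card T = k"
      using \<sigma> by (auto simp: total_cut_complex_def)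
    have "T \<subseteq> S" using T \<sigma> S by blast
    moreover have "finite S" using S assms finite_subset by blast
    ultimately have "T = S" using T S card_subset_eq by metis
    then show ?thesis using T \<sigma> S by blast
  qed
  ultimately show "F \<in> complex_facets (total_cut_complex V E k)"
    by (auto simp: complex_facets_def)
qed

end

theory Submission
  imports Defs
begin

text \<open>Let \<open>v\<close> be a simplicial vertex of \<open>V\<close>. The link of \<open>v\<close> in the total \<open>k\<close>-cut complex is the total
  \<open>k\<close>-cut complex of \<open>V - {v}\<close>. An independent set contains at most one neighbour of \<open>v\<close>, which can be
  exchanged for \<open>v\<close>; so the deletion of \<open>v\<close> is pure, and it is the total \<open>(k - 1)\<close>-cut complex of the
  non-neighbours of \<open>v\<close>, coned over its neighbours. Both are smaller instances, and the same exchange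
  shows that listing the independent \<open>k\<close>-sets through \<open>v\<close> before the others shells the complex.

  For the existence of simplicial vertices (Dirac), let \<open>C\<close> be a component of the graph induced on
  the non-neighbours of a vertex \<open>v\<close>. The neighbourhood \<open>N\<close> of \<open>C\<close> is a clique, since a shortest path
  through \<open>C\<close> between two nonadjacent vertices of \<open>N\<close> would close up with \<open>v\<close> to a long induced cycle;
  induction on \<open>C \<union> N\<close> or \<open>C\<close> then gives a simplicial vertex in \<open>C\<close>.\<close>

section \<open>Simplicial vertices of chordal graphs\<close>

definition simplicial :: "'a set \<Rightarrow> 'a set set \<Rightarrow> 'a \<Rightarrow> bool" where
  "simplicial V E v \<longleftrightarrow> v \<in> V \<and>
     (\<forall>x\<in>V. \<forall>y\<in>V. {v, x} \<in> E \<longrightarrow> {v, y} \<in> E \<longrightarrow> x \<noteq> y \<longrightarrow> {x, y} \<in> E)"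

lemma chordal_graph_subset: "chordal_graph V E \<Longrightarrow> U \<subseteq> V \<Longrightarrow> chordal_graph U E"
  unfolding chordal_graph_def induced_cycle_def by blast

section \<open>Walks, shortcuts and shortest walks\<close>

definition is_walk :: "'a set \<Rightarrow> 'a set set \<Rightarrow> 'a \<Rightarrow> 'a \<Rightarrow> 'a list \<Rightarrow> bool" where
  "is_walk U E x y p \<longleftrightarrow> p \<noteq> [] \<and> hd p = x \<and> last p = y \<and> set p \<subseteq> U \<and>
     successively (\<lambda>a b. {a, b} \<in> E) p"

text \<open>Follows a chord from position \<open>i\<close> to position \<open>j\<close>. Unless
  \<open>j = Suc i\<close> the result is strictly shorter, so a shortest walk has no chords.\<close>

lemma is_walk_splice:
  assumes p: "is_walk U E x y p" and "i < j" "j < length p" "{p ! i, p ! j} \<in> E"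
  shows "is_walk U E x y (take (Suc i) p @ drop j p)"
proof -
  have p': "p \<noteq> []" "hd p = x" "last p = y" "set p \<subseteq> U" "successively (\<lambda>a b. {a, b} \<in> E) p"
    using p by (auto simp: is_walk_def)
  have "successively (\<lambda>a b. {a, b} \<in> E) (take (Suc i) p)"
    "successively (\<lambda>a b. {a, b} \<in> E) (drop j p)"
    using p'(5) assms by (auto simp: successively_conv_nth)
  moreover have "last (take (Suc i) p) = p ! i"
    using assms by (simp add: take_Suc_conv_app_nth)
  moreover have "hd (drop j p) = p ! j"
    using assms by (simp add: hd_drop_conv_nth)
  moreover have "set (take (Suc i) p) \<subseteq> U" "set (drop j p) \<subseteq> U"
    using p'(4) set_take_subset set_drop_subset by fast+
  ultimately show ?thesis
    using p' assms by (auto simp: is_walk_def successively_append_iff)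
qed

text \<open>Cuts out the closed detour between two visits to the same vertex. The result is strictly
  shorter, so a shortest walk repeats no vertex.\<close>

lemma is_walk_skip:
  assumes p: "is_walk U E x y p" and "i < j" "j < length p" "p ! i = p ! j"
  shows "is_walk U E x y (take i p @ drop j p)"
proof -
  have p': "p \<noteq> []" "hd p = x" "last p = y" "set p \<subseteq> U" "successively (\<lambda>a b. {a, b} \<in> E) p"
    using p by (auto simp: is_walk_def)
  have sub: "set (take i p) \<subseteq> U" "set (drop j p) \<subseteq> U"
    using p'(4) set_take_subset set_drop_subset by fast+
  have suc: "successively (\<lambda>a b. {a, b} \<in> E) (take i p)"
    "successively (\<lambda>a b. {a, b} \<in> E) (drop j p)"
    using p'(5) assms by (auto simp: successively_conv_nth)
  have hd: "hd (drop j p) = p ! j"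
    using assms by (simp add: hd_drop_conv_nth)
  show ?thesis
  proof (cases i)
    \<comment> \<open>The kept prefix is empty, so the start \<open>x\<close> is supplied by
      \<open>p ! j = p ! 0\<close>.\<close>
    case 0
    then have "hd (drop j p) = x"
      using hd p' assms by (simp add: hd_conv_nth)
    then show ?thesis
      using 0 p' sub suc assms by (auto simp: is_walk_def)
  next
    case (Suc h)
    have "last (take i p) = p ! h"
      using Suc assms by (simp add: take_Suc_conv_app_nth)
    moreover have "{p ! h, p ! i} \<in> E"
      using p'(5) Suc assms(2,3) by (simp add: successively_conv_nth)
    ultimately show ?thesis
      using Suc hd p' sub suc assms by (auto simp: is_walk_def successively_append_iff)
  qed
qed

text \<open>By the two shortcuts above, a walk with the fewest vertices is an induced path.\<close>

lemma shortest_walk_exists: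
  assumes "is_walk U E x y q"
  obtains p where "is_walk U E x y p" "distinct p"
    "\<And>i j. i < j \<Longrightarrow> j < length p \<Longrightarrow> {p ! i, p ! j} \<in> E \<Longrightarrow> j = Suc i"
proof -
  define p where "p = arg_min length (is_walk U E x y)"
  have p: "is_walk U E x y p"
    unfolding p_def using assms by (rule arg_min_natI)
  have min: "length p \<le> length r" if "is_walk U E x y r" for r
    unfolding p_def using that by (rule arg_min_nat_le)
  have "p ! i \<noteq> p ! j" if "i < j" "j < length p" for i j
    using min[OF is_walk_skip[OF p that]] that by auto
  then have "distinct p"
    by (metis distinct_conv_nth linorder_neqE_nat)
  moreover have "j = Suc i" if "i < j" "j < length p" "{p ! i, p ! j} \<in> E" for i j
    using min[OF is_walk_splice[OF p that]] that by auto
  ultimately show thesis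
    using that p by blast
qed

lemma chordal_neighbours_adjacent:
  assumes ch: "chordal_graph V E" and loop: "\<And>z. {z} \<notin> E"
    and U: "U \<subseteq> V" "v \<in> V" "v \<notin> U" "\<And>u. u \<in> U \<Longrightarrow> {v, u} \<notin> E"
    and x: "x \<in> V" "{v, x} \<in> E" and y: "y \<in> V" "{v, y} \<in> E" and "x \<noteq> y"
    and walk: "is_walk (U \<union> {x, y}) E x y q"
  shows "{x, y} \<in> E"
proof (rule ccontr)
  assume nadj: "{x, y} \<notin> E"
  obtain p where p: "is_walk (U \<union> {x, y}) E x y p" and dist: "distinct p"
    and short: "\<And>i j. i < j \<Longrightarrow> j < length p \<Longrightarrow> {p ! i, p ! j} \<in> E \<Longrightarrow> j = Suc i"
    using shortest_walk_exists[OF walk] by metis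
  define n where "n = length p"
  have p': "p \<noteq> []" "p ! 0 = x" "p ! (n - 1) = y" "set p \<subseteq> U \<union> {x, y}"
    "\<And>i. Suc i < n \<Longrightarrow> {p ! i, p ! Suc i} \<in> E"
    using p by (auto simp: is_walk_def hd_conv_nth last_conv_nth n_def successively_conv_nth)
  \<comment> \<open>Since \<open>x\<close> and \<open>y\<close> are distinct and assumed
    nonadjacent, the path has an interior vertex; with \<open>v\<close> the cycle gets at least four
    vertices.\<close>
  have n: "n \<ge> 3"
  proof (rule ccontr)
    assume "\<not> n \<ge> 3"
    moreover have "n > 0" using p'(1) by (simp add: n_def)
    ultimately consider "n = 1" | "n = 2" by linarith
    then show False
      using p'(2,3) p'(5)[of 0] \<open>x \<noteq> y\<close> nadj by cases auto
  qed
  have adj_p: "{p ! i, p ! j} \<in> E \<longleftrightarrow> j = Suc i \<or> i = Suc j" if "i < n" "j < n" for i j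
    using that p'(5) short[of i j] short[of j i] loop[of "p ! i"]
    by (cases i j rule: linorder_cases) (auto simp: n_def insert_commute)
  \<comment> \<open>Only the ends of the path can lie outside \<open>U\<close>, and no vertex of
    \<open>U\<close> is adjacent to \<open>v\<close>.\<close>
  have adj_v: "{v, p ! i} \<in> E \<longleftrightarrow> i = 0 \<or> i = n - 1" if "i < n" for i
  proof
    assume *: "{v, p ! i} \<in> E"
    then have "p ! i \<in> {p ! 0, p ! (n - 1)}"
    proof -
      have "p ! i \<in> set p" using that by (simp add: n_def)
      then show ?thesis using * p'(2-4) U(4) by blast
    qed
    then show "i = 0 \<or> i = n - 1"
      using dist that p'(1) by (auto simp: n_def nth_eq_iff_index_eq)
  next
    assume "i = 0 \<or> i = n - 1"
    then show "{v, p ! i} \<in> E"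
      using p'(2,3) x y by auto
  qed
  have "induced_cycle V E (v # p)"
    unfolding induced_cycle_def
  proof (intro conjI allI impI)
    show "3 \<le> length (v # p)" using n by (simp add: n_def)
    have "v \<noteq> x" "v \<noteq> y" using x y loop by auto
    then show "distinct (v # p)"
      using dist p'(4) U(3) by auto
    show "set (v # p) \<subseteq> V" using p'(4) U x y by auto
    fix i j assume "i < length (v # p)" "j < length (v # p)"
    then have ij: "i \<le> n" "j \<le> n" by (auto simp: n_def)
    \<comment> \<open>The cycle has \<open>n + 1\<close> vertices: index \<open>0\<close> is
      \<open>v\<close> and index \<open>Suc a\<close> is \<open>p ! a\<close>, so the wrap-around
      happens at index \<open>n\<close>.\<close>
    have md: "Suc i mod length (v # p) = (if i = n then 0 else Suc i)"
      "Suc j mod length (v # p) = (if j = n then 0 else Suc j)"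
      using ij by (auto simp: n_def)
    show "{(v # p) ! i, (v # p) ! j} \<in> E \<longleftrightarrow>
        j = Suc i mod length (v # p) \<or> i = Suc j mod length (v # p)"
    proof (cases i; cases j)
      assume "i = 0" "j = 0"
      then show ?thesis using md loop[of v] n by auto
    next
      fix b assume "i = 0" "j = Suc b"
      then show ?thesis using md adj_v[of b] ij n by auto
    next
      fix a assume "i = Suc a" "j = 0"
      then show ?thesis using md adj_v[of a] ij n by (auto simp: insert_commute)
    next
      fix a b assume "i = Suc a" "j = Suc b"
      then show ?thesis using md adj_p[of a b] ij n by auto
    qed
  qed
  moreover have "length (v # p) > 3" using n by (simp add: n_def)
  ultimately show False using ch unfolding chordal_graph_def by blast
qed

section \<open>Dirac's theorem on simplicial vertices\<close>

lemma rtranclp_is_walk: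
  assumes "(\<lambda>a b. a \<in> U \<and> b \<in> U \<and> {a, b} \<in> E)\<^sup>*\<^sup>* a b" "a \<in> U"
  shows "\<exists>p. is_walk U E a b p"
  using assms
proof (induction rule: rtranclp_induct)
  case base
  then have "is_walk U E a a [a]" by (simp add: is_walk_def)
  then show ?case by blast
next
  case (step b c)
  then obtain p where "is_walk U E a b p" by blast
  then have "is_walk U E a c (p @ [c])"
    using step by (auto simp: is_walk_def successively_append_iff)
  then show ?case by blast
qed

text \<open>Prescribing a vertex \<open>v\<close> to stay away from strengthens mere existence
  enough for the induction: applied to a vertex of the separating clique \<open>N\<close>, it forces
  the simplicial vertex found to lie in the component \<open>C\<close>.\<close>

theorem chordal_simplicial_outside:
  assumes "finite V" "chordal_graph V E" and loop: "\<And>z. {z} \<notin> E"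
    and "v \<in> V" "w \<in> V" "w \<noteq> v" "{v, w} \<notin> E"
  shows "\<exists>s. simplicial V E s \<and> s \<noteq> v \<and> {v, s} \<notin> E"
  using assms(1,2,4-)
proof (induction "card V" arbitrary: V v w rule: less_induct)
  case less
  define U where "U = {u \<in> V. u \<noteq> v \<and> {v, u} \<notin> E}"
  define R where "R = (\<lambda>a b. a \<in> U \<and> b \<in> U \<and> {a, b} \<in> E)"
  define C where "C = {u. R\<^sup>*\<^sup>* w u}"
  define N where "N = {x \<in> V - C. \<exists>a\<in>C. {x, a} \<in> E}"
  have wU: "w \<in> U" using less.prems by (auto simp: U_def)
  have symR: "R\<^sup>*\<^sup>* b a" if "R\<^sup>*\<^sup>* a b" for a b
  proof -
    have "symp R" by (auto simp: R_def symp_def insert_commute)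
    then show ?thesis using that by (metis sympD symp_rtranclp)
  qed
  have CU: "C \<subseteq> U"
  proof
    fix u assume "u \<in> C"
    then have "R\<^sup>*\<^sup>* w u" by (simp add: C_def)
    then show "u \<in> U" by (induction) (auto simp: wU R_def)
  qed
  have wC: "w \<in> C" by (simp add: C_def)
  have Cext: "b \<in> C" if "a \<in> C" "b \<in> U" "{b, a} \<in> E" for a b
  proof -
    have "R a b" using that CU by (auto simp: R_def insert_commute)
    then show ?thesis using that unfolding C_def by auto
  qed
  \<comment> \<open>A non-neighbour of \<open>v\<close> other than \<open>v\<close> that is adjacent
    to \<open>C\<close> would already belong to \<open>C\<close>.\<close>
  have Nv: "{v, x} \<in> E" if xN: "x \<in> N" for x
  proof -
    obtain a where a: "a \<in> C" "{x, a} \<in> E" "x \<in> V" "x \<notin> C"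
      using xN unfolding N_def by blast
    have "x \<notin> U" using Cext a by blast
    moreover have "x \<noteq> v" using a CU by (auto simp: U_def)
    ultimately show ?thesis using a by (auto simp: U_def)
  qed
  have clique: "{x, y} \<in> E" if xy: "x \<in> N" "y \<in> N" "x \<noteq> y" for x y
  proof -
    obtain a b where a: "a \<in> C" "{x, a} \<in> E" and b: "b \<in> C" "{y, b} \<in> E"
      using xy unfolding N_def by blast
    have "R\<^sup>*\<^sup>* a b"
      using a(1) b(1) symR unfolding C_def by (metis mem_Collect_eq rtranclp_trans)
    then obtain p where p: "is_walk U E a b p"
      using rtranclp_is_walk[of U E a b] a CU unfolding R_def by blast
    \<comment> \<open>The detour from \<open>x\<close> to \<open>y\<close> enters \<open>C\<close>
      at \<open>a\<close>, runs inside \<open>U\<close> and leaves at \<open>b\<close>.\<close>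
    have "is_walk (U \<union> {x, y}) E x y (x # p @ [y])"
      using p a b
      by (auto simp: is_walk_def successively_append_iff successively_Cons insert_commute)
    moreover have "x \<in> V" "y \<in> V" using xy by (simp_all add: N_def)
    moreover have "U \<subseteq> V" "v \<notin> U" "\<And>u. u \<in> U \<Longrightarrow> {v, u} \<notin> E" by (auto simp: U_def)
    ultimately show ?thesis
      using chordal_neighbours_adjacent[OF less.prems(2) loop _ less.prems(3)] xy Nv by metis
  qed
  \<comment> \<open>All neighbours in \<open>V\<close> of a vertex of \<open>C\<close> lie in
    \<open>C \<union> N\<close>, so being simplicial there is the same as being simplicial in
    \<open>V\<close>; nonadjacency to \<open>v\<close> comes from
    \<open>C \<subseteq> U\<close>.\<close>
  have lift: "simplicial V E s \<and> s \<noteq> v \<and> {v, s} \<notin> E" if s: "simplicial (C \<union> N) E s" "s \<in> C" for s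
  proof -
    have "x \<in> C \<union> N" if "x \<in> V" "{s, x} \<in> E" for x
      using that s by (auto simp: N_def insert_commute)
    moreover have "s \<in> U" using s CU by blast
    ultimately show ?thesis using s unfolding simplicial_def U_def by blast
  qed
  \<comment> \<open>The loss of \<open>v\<close> makes every subset of \<open>C \<union> N\<close> a
    smaller instance.\<close>
  have sub: "C \<union> N \<subseteq> V - {v}" using CU Nv loop by (auto simp: U_def N_def)
  have IH: "\<exists>s. simplicial A E s \<and> s \<noteq> a \<and> {a, s} \<notin> E"
    if "A \<subseteq> C \<union> N" "a \<in> A" "b \<in> A" "b \<noteq> a" "{a, b} \<notin> E" for A a b
  proof -
    have "A \<subset> V" using that sub less.prems by blast
    then show ?thesis
      using less.hyps[of A a b] that less.prems chordal_graph_subset[of V E A]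
        psubset_card_mono[of V A] finite_subset[of A V] by auto
  qed
  show ?case
  proof (cases "\<exists>a\<in>N. \<exists>b\<in>C \<union> N. b \<noteq> a \<and> {a, b} \<notin> E")
    \<comment> \<open>The induction yields a simplicial vertex nonadjacent to \<open>a\<close>. It
      is not in the clique \<open>N\<close>, which contains \<open>a\<close>, hence it is in
      \<open>C\<close>.\<close>
    case True
    then obtain a s where "a \<in> N" "simplicial (C \<union> N) E s" "s \<noteq> a" "{a, s} \<notin> E"
      using IH[of "C \<union> N"] by blast
    moreover from this have "s \<in> C"
      using clique[of a s] by (auto simp: simplicial_def)
    ultimately show ?thesis using lift by blast
  next
    \<comment> \<open>Every vertex of \<open>N\<close> is now adjacent to all others of
      \<open>C \<union> N\<close>, so a simplicial vertex of \<open>C\<close> stays simplicial when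
      \<open>N\<close> is added.\<close>
    case False
    have "\<exists>s. simplicial C E s"
    proof (cases "\<exists>a\<in>C. \<exists>b\<in>C. b \<noteq> a \<and> {a, b} \<notin> E")
      case True
      then show ?thesis using IH[of C] by blast
    next
      \<comment> \<open>Here \<open>C\<close> is complete and any of its vertices is
        simplicial.\<close>
      case False
      then have "simplicial C E w" using wC by (auto simp: simplicial_def)
      then show ?thesis by blast
    qed
    then obtain s where s: "simplicial C E s" by blast
    then have "s \<in> C" by (simp add: simplicial_def)
    have "simplicial (C \<union> N) E s"
      unfolding simplicial_def
    proof (intro conjI ballI impI)
      show "s \<in> C \<union> N" using \<open>s \<in> C\<close> by blast
      fix x y assume "x \<in> C \<union> N" "y \<in> C \<union> N" "{s, x} \<in> E" "{s, y} \<in> E" "x \<noteq> y"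
      then consider "x \<in> C" "y \<in> C" | "x \<in> N" | "y \<in> N" by blast
      then show "{x, y} \<in> E"
      proof cases
        case 1
        then show ?thesis using s \<open>{s, x} \<in> E\<close> \<open>{s, y} \<in> E\<close> \<open>x \<noteq> y\<close>
          by (auto simp: simplicial_def)
      next
        case 2
        then show ?thesis using False \<open>y \<in> C \<union> N\<close> \<open>x \<noteq> y\<close> by auto
      next
        case 3
        then have "{y, x} \<in> E" using False \<open>x \<in> C \<union> N\<close> \<open>x \<noteq> y\<close> by auto
        then show ?thesis by (simp add: insert_commute)
      qed
    qed
    then show ?thesis using lift \<open>s \<in> C\<close> by blast
  qed
qed

corollary chordal_simplicial_exists:
  assumes "finite V" "chordal_graph V E" "\<And>z. {z} \<notin> E" "V \<noteq> {}"
  shows "\<exists>s. simplicial V E s"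
proof (cases "\<exists>a\<in>V. \<exists>b\<in>V. b \<noteq> a \<and> {a, b} \<notin> E")
  case True
  then show ?thesis using chordal_simplicial_outside[OF assms(1-3)] by blast
next
  case False
  obtain s where "s \<in> V" using assms(4) by blast
  with False have "simplicial V E s" by (auto simp: simplicial_def)
  then show ?thesis by blast
qed

section \<open>Vertex decomposability\<close>

definition non_nbrs :: "'a set \<Rightarrow> 'a set set \<Rightarrow> 'a \<Rightarrow> 'a set" where
  "non_nbrs V E v = {u \<in> V. u \<noteq> v \<and> {v, u} \<notin> E}"

lemma indep_insert_non_nbrs:
  assumes "indep S E" "S \<subseteq> non_nbrs V E v"
  shows "indep (insert v S) E"
proof -
  have "{v, s} \<notin> E" "{s, v} \<notin> E" if "s \<in> S" for s
    using that assms(2) by (auto simp: non_nbrs_def insert_commute)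
  then show ?thesis using assms(1) unfolding indep_def by blast
qed

text \<open>The neighbours of \<open>v\<close> form a clique, so \<open>S\<close> contains at most
  one of them: that one is dropped. If there is none, any element may be dropped, and nonemptiness
  provides one.\<close>

lemma simplicial_exchange:
  assumes v: "simplicial V E v" and S: "S \<subseteq> V" "v \<notin> S" "indep S E" "S \<noteq> {}"
  shows "\<exists>s\<in>S. S - {s} \<subseteq> non_nbrs V E v"
proof (cases "\<exists>s\<in>S. {v, s} \<in> E")
  case True
  then obtain s where s: "s \<in> S" "{v, s} \<in> E" by blast
  have "{v, t} \<notin> E" if "t \<in> S - {s}" for t
    using v S s that unfolding simplicial_def indep_def by blast
  then show ?thesis using s S unfolding non_nbrs_def by blast
next
  case False
  then show ?thesis using S unfolding non_nbrs_def by blast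
qed

text \<open>The cone over the total cut complex of \<open>V\<close> with apex simplex \<open>W - V\<close>. Unlike total cut
  complexes, this family is closed under deleting a simplicial vertex, whose neighbours become cone
  points.\<close>

definition coned_cut_complex :: "'a set \<Rightarrow> 'a set \<Rightarrow> 'a set set \<Rightarrow> nat \<Rightarrow> 'a set set" where
  "coned_cut_complex W V E k =
     {\<sigma>. \<sigma> \<subseteq> W \<and> (\<exists>S. S \<subseteq> V - \<sigma> \<and> indep S E \<and> card S = k)}"

lemma coned_cut_complex_self: "coned_cut_complex V V E k = total_cut_complex V E k"
  by (simp add: coned_cut_complex_def total_cut_complex_def)

section \<open>Facets, dimension, link and deletion of coned cut complexes\<close>

lemma is_complex_coned_cut_complex:
  assumes "finite W"
  shows "is_complex (coned_cut_complex W V E k)"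
proof -
  have "\<Union>(coned_cut_complex W V E k) \<subseteq> W"
    by (auto simp: coned_cut_complex_def)
  then have "finite (\<Union>(coned_cut_complex W V E k))"
    using assms finite_subset by blast
  then show ?thesis
    unfolding is_complex_def coned_cut_complex_def by blast
qed

text \<open>A face with witness \<open>S\<close> can be enlarged to the face \<open>W - S\<close>,
  so by maximality a facet has this form.\<close>

lemma coned_cut_complex_facet_card:
  assumes "finite W" "V \<subseteq> W" "F \<in> complex_facets (coned_cut_complex W V E k)"
  shows "int (card F) = int (card W) - int k"
proof -
  obtain S where S: "F \<subseteq> W" "S \<subseteq> V - F" "indep S E" "card S = k"
    using assms by (auto simp: complex_facets_def coned_cut_complex_def)
  have "W - S \<in> coned_cut_complex W V E k" "F \<subseteq> W - S"
    using S assms by (auto simp: coned_cut_complex_def)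
  then have "F = W - S" using assms(3) by (auto simp: complex_facets_def)
  moreover have "S \<subseteq> W" "finite S" using S assms finite_subset[of S W] by auto
  ultimately show ?thesis
    using S assms card_mono[of W S] by (auto simp: card_Diff_subset of_nat_diff)
qed

text \<open>A face and its witness are disjoint subsets of \<open>W\<close>, which bounds the
  dimension; \<open>W - S\<close> attains the bound. Nonvoidness supplies such an
  \<open>S\<close>.\<close>

lemma complex_dim_coned_cut_complex:
  assumes "finite W" "V \<subseteq> W" "coned_cut_complex W V E k \<noteq> {}"
  shows "complex_dim (coned_cut_complex W V E k) = int (card W) - int k - 1"
proof -
  let ?D = "coned_cut_complex W V E k"
  have le: "face_dim \<sigma> \<le> int (card W) - int k - 1" if \<sigma>: "\<sigma> \<in> ?D" for \<sigma>
  proof -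
    obtain S where S: "\<sigma> \<subseteq> W" "S \<subseteq> V - \<sigma>" "card S = k"
      using \<sigma> by (auto simp: coned_cut_complex_def)
    have "finite S" "finite \<sigma>" using S assms by (meson Diff_subset finite_subset subset_trans)+
    then have "card (\<sigma> \<union> S) = card \<sigma> + k"
      using S by (subst card_Un_disjoint) auto
    moreover have "card (\<sigma> \<union> S) \<le> card W"
      using S assms by (intro card_mono) auto
    ultimately show ?thesis by (simp add: face_dim_def)
  qed
  have fin: "finite ?D"
    by (rule finite_subset[of _ "Pow W"]) (use assms in \<open>auto simp: coned_cut_complex_def\<close>)
  obtain S where S: "S \<subseteq> V" "indep S E" "card S = k"
    using assms(3) unfolding coned_cut_complex_def by blast
  have "W - S \<in> ?D" using S by (auto simp: coned_cut_complex_def)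
  moreover have "face_dim (W - S) = int (card W) - int k - 1"
  proof -
    have "S \<subseteq> W" "finite S" using S assms finite_subset[of S W] by auto
    then show ?thesis
      using S assms card_mono[of W S] by (auto simp: card_Diff_subset of_nat_diff face_dim_def)
  qed
  ultimately have "int (card W) - int k - 1 \<in> face_dim ` ?D" by force
  then show ?thesis
    unfolding complex_dim_def using le fin by (intro Max_eqI) auto
qed

lemma complex_link_coned_cut_complex:
  assumes "v \<in> W"
  shows "complex_link (coned_cut_complex W V E k) v = coned_cut_complex (W - {v}) (V - {v}) E k"
proof (intro equalityI subsetI)
  fix \<tau> assume "\<tau> \<in> complex_link (coned_cut_complex W V E k) v"
  then obtain S where "\<tau> \<subseteq> W - {v}" "S \<subseteq> V - (\<tau> \<union> {v})" "indep S E" "card S = k"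
    unfolding complex_link_def coned_cut_complex_def by blast
  moreover from this have "S \<subseteq> V - {v} - \<tau>" by blast
  ultimately show "\<tau> \<in> coned_cut_complex (W - {v}) (V - {v}) E k"
    unfolding coned_cut_complex_def by blast
next
  fix \<tau> assume "\<tau> \<in> coned_cut_complex (W - {v}) (V - {v}) E k"
  then obtain S where "\<tau> \<subseteq> W - {v}" "S \<subseteq> V - {v} - \<tau>" "indep S E" "card S = k"
    unfolding coned_cut_complex_def by blast
  moreover from this have "S \<subseteq> V - \<tau>" "S \<subseteq> V - (\<tau> \<union> {v})" by blast+
  ultimately show "\<tau> \<in> complex_link (coned_cut_complex W V E k) v"
    unfolding complex_link_def coned_cut_complex_def using assms by blast
qed

text \<open>Downwards, a witness loses \<open>v\<close> itself or the vertex given by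
  \<open>simplicial_exchange\<close>, and the rest are non-neighbours of \<open>v\<close>. Upwards,
  \<open>v\<close> is added to the witness, which is possible because a face of the deletion leaves
  \<open>v\<close> free.\<close>

lemma complex_del_coned_cut_complex:
  assumes "finite V" "simplicial V E v"
  shows "complex_del (coned_cut_complex W V E (Suc k)) v =
    coned_cut_complex (W - {v}) (non_nbrs V E v) E k"
proof (intro equalityI subsetI)
  fix \<tau> assume "\<tau> \<in> complex_del (coned_cut_complex W V E (Suc k)) v"
  then obtain S where S: "\<tau> \<subseteq> W - {v}" "S \<subseteq> V - \<tau>" "indep S E" "card S = Suc k"
    unfolding complex_del_def coned_cut_complex_def by blast
  have "\<exists>s\<in>S. S - {s} \<subseteq> non_nbrs V E v"
  proof (cases "v \<in> S")
    case True
    then have "S - {v} \<subseteq> non_nbrs V E v"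
      using S(2,3) by (auto simp: non_nbrs_def indep_def)
    then show ?thesis using True by blast
  next
    case False
    then show ?thesis
      using simplicial_exchange[OF assms(2), of S] S(2-4) by fastforce
  qed
  then obtain s where s: "s \<in> S" "S - {s} \<subseteq> non_nbrs V E v" by blast
  have "S - {s} \<subseteq> non_nbrs V E v - \<tau>" using s S by blast
  moreover have "card (S - {s}) = k" using s S by simp
  moreover have "indep (S - {s}) E" using S by (auto simp: indep_def)
  ultimately show "\<tau> \<in> coned_cut_complex (W - {v}) (non_nbrs V E v) E k"
    unfolding coned_cut_complex_def using S by blast
next
  fix \<tau> assume "\<tau> \<in> coned_cut_complex (W - {v}) (non_nbrs V E v) E k"
  then obtain S where S: "\<tau> \<subseteq> W - {v}" "S \<subseteq> non_nbrs V E v - \<tau>" "indep S E" "card S = k"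
    unfolding coned_cut_complex_def by blast
  have "finite S" using S assms finite_subset[of S V] by (auto simp: non_nbrs_def)
  moreover have "v \<notin> S" using S by (auto simp: non_nbrs_def)
  ultimately have "card (insert v S) = Suc k" using S by simp
  moreover have "insert v S \<subseteq> V - \<tau>"
    using S assms by (auto simp: non_nbrs_def simplicial_def)
  moreover have "indep (insert v S) E"
    using S(2,3) by (intro indep_insert_non_nbrs[of S E V v]) auto
  ultimately show "\<tau> \<in> complex_del (coned_cut_complex W V E (Suc k)) v"
    unfolding complex_del_def coned_cut_complex_def using S by blast
qed

section \<open>The induction for vertex decomposability\<close>

lemma card_non_nbrs_less:
  assumes "finite V" "v \<in> V"
  shows "card (non_nbrs V E v) < card V"
  using assms by (intro psubset_card_mono) (auto simp: non_nbrs_def)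

text \<open>The induction on \<open>card V\<close> keeps \<open>W\<close> and \<open>k\<close>
  general: the link removes \<open>v\<close> from both \<open>W\<close> and \<open>V\<close> and
  keeps \<open>k\<close>, while the deletion shrinks \<open>V\<close> to the non-neighbours and
  lowers \<open>k\<close> by one.\<close>

theorem vertex_decomposable_coned_cut_complex:
  assumes "finite W" "V \<subseteq> W" "chordal_graph V E" and loop: "\<And>z. {z} \<notin> E"
  shows "vertex_decomposable (coned_cut_complex W V E k)"
  using assms(1-3)
proof (induction "card V" arbitrary: V W k rule: less_induct)
  case less
  let ?D = "coned_cut_complex W V E k"
  have finV: "finite V" using less.prems finite_subset by blast
  consider "k = 0" | "?D = {}" | l where "k = Suc l" "?D \<noteq> {}"
    by (cases k) auto
  then show ?case
  proof cases
    case 1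
    \<comment> \<open>The empty witness makes every subset of \<open>W\<close> a face, so the
      complex is a simplex.\<close>
    have "indep {} E" "card {} = 0" by (auto simp: indep_def)
    then have "?D = Pow W"
      unfolding coned_cut_complex_def 1 by blast
    then show ?thesis using less.prems by (simp add: vertex_decomposable.simplex)
  next
    case 2
    then show ?thesis by (simp add: vertex_decomposable.void)
  next
    case 3
    then have "V \<noteq> {}" unfolding coned_cut_complex_def by force
    then obtain v where v: "simplicial V E v"
      using chordal_simplicial_exists finV less.prems loop by blast
    then have vV: "v \<in> V" "v \<in> W" using less.prems by (auto simp: simplicial_def)
    note del = complex_del_coned_cut_complex[OF finV v, of W l, folded 3(1)]
    have nn: "non_nbrs V E v \<subseteq> V - {v}" by (auto simp: non_nbrs_def)
    have D: "vertex_decomposable (complex_del ?D v)"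
      unfolding del using nn less.prems vV finV
      by (intro less.hyps card_non_nbrs_less) (auto intro: chordal_graph_subset)
    show ?thesis
    proof (cases "{v} \<in> ?D")
      case True
      have "vertex_decomposable (complex_link ?D v)"
        unfolding complex_link_coned_cut_complex[OF vV(2)] using less.prems vV finV
        by (intro less.hyps psubset_card_mono) (auto intro: chordal_graph_subset)
      moreover have "pure_of_dim (complex_del ?D v) (complex_dim ?D)"
        unfolding pure_of_dim_def
      proof
        fix F assume "F \<in> complex_facets (complex_del ?D v)"
        \<comment> \<open>Passing to the deletion lowers both the ground set size and
          \<open>k\<close> by one, so their difference, and with it the dimension, is
          unchanged.\<close>
        then have "int (card F) = int (card (W - {v})) - int l"
          unfolding del using nn less.prems
          by (intro coned_cut_complex_facet_card) auto
        moreover have "card W > 0" using vV less.prems by (auto simp: card_gt_0_iff)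
        ultimately show "face_dim F = complex_dim ?D"
          using complex_dim_coned_cut_complex[OF less.prems(1,2) 3(2)] 3(1) vV less.prems
          by (simp add: face_dim_def)
      qed
      ultimately show ?thesis
        using D True is_complex_coned_cut_complex[OF less.prems(1)]
        by (blast intro: vertex_decomposable.shed)
    next
      case False
      \<comment> \<open>If \<open>{v}\<close> is not a face, \<open>v\<close> cannot be shed; but
        then no face contains \<open>v\<close> and the complex equals its deletion.\<close>
      have "v \<notin> \<sigma>" if "\<sigma> \<in> ?D" for \<sigma>
        using that False is_complex_coned_cut_complex[OF less.prems(1), of V E k]
        unfolding is_complex_def by blast
      then have "complex_del ?D v = ?D" by (auto simp: complex_del_def)
      then show ?thesis using D by simp
    qed
  qed
qed

section \<open>Shellability\<close>

text \<open>The shelling condition for the facets \<open>V - S\<close>, expressed through the complements \<open>S\<close>.\<close>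

definition exchange_ordered :: "'a set list \<Rightarrow> bool" where
  "exchange_ordered Ss \<longleftrightarrow>
     (\<forall>j<length Ss. \<forall>i<j. \<exists>l<j. Ss ! l \<subseteq> Ss ! i \<union> Ss ! j \<and> card (Ss ! l - Ss ! j) = 1)"

section \<open>Building exchange orders\<close>

lemma exchange_ordered_map_insert:
  assumes "exchange_ordered Ss" "\<And>S. S \<in> set Ss \<Longrightarrow> v \<notin> S"
  shows "exchange_ordered (map (insert v) Ss)"
  unfolding exchange_ordered_def
proof (intro allI impI)
  fix i j assume ij: "j < length (map (insert v) Ss)" "i < j"
  then obtain l where l: "l < j" "Ss ! l \<subseteq> Ss ! i \<union> Ss ! j" "card (Ss ! l - Ss ! j) = 1"
    using assms(1) unfolding exchange_ordered_def length_map by blast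
  have "v \<notin> Ss ! l" using assms(2) l ij by simp
  then have "insert v (Ss ! l) - insert v (Ss ! j) = Ss ! l - Ss ! j" by blast
  then show "\<exists>l<j. map (insert v) Ss ! l \<subseteq> map (insert v) Ss ! i \<union> map (insert v) Ss ! j \<and>
      card (map (insert v) Ss ! l - map (insert v) Ss ! j) = 1"
    using l ij by (intro exI[of _ l]) auto
qed

text \<open>For a pair split between the blocks, any member of \<open>As\<close> may serve as the
  exchange partner, since all of \<open>As\<close> precedes all of \<open>Bs\<close>.\<close>

lemma exchange_ordered_append:
  assumes "exchange_ordered As" "exchange_ordered Bs"
    and cross: "\<And>A B. A \<in> set As \<Longrightarrow> B \<in> set Bs \<Longrightarrow>
      \<exists>A'\<in>set As. A' \<subseteq> A \<union> B \<and> card (A' - B) = 1"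
  shows "exchange_ordered (As @ Bs)"
  unfolding exchange_ordered_def
proof (intro allI impI)
  let ?Ss = "As @ Bs" and ?m = "length As"
  fix i j assume ij: "j < length ?Ss" "i < j"
  consider "j < ?m" | "i < ?m" "?m \<le> j" | "?m \<le> i" using ij by linarith
  then show "\<exists>l<j. ?Ss ! l \<subseteq> ?Ss ! i \<union> ?Ss ! j \<and> card (?Ss ! l - ?Ss ! j) = 1"
  proof cases
    case 1
    then obtain l where "l < j" "As ! l \<subseteq> As ! i \<union> As ! j" "card (As ! l - As ! j) = 1"
      using assms(1) ij unfolding exchange_ordered_def by blast
    then show ?thesis using 1 ij by (intro exI[of _ l]) (auto simp: nth_append)
  next
    case 2
    then have "As ! i \<in> set As" "Bs ! (j - ?m) \<in> set Bs" using ij by auto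
    then obtain l where "l < ?m" "As ! l \<subseteq> As ! i \<union> Bs ! (j - ?m)"
      "card (As ! l - Bs ! (j - ?m)) = 1"
      using cross by (metis in_set_conv_nth)
    then show ?thesis using 2 by (intro exI[of _ l]) (auto simp: nth_append)
  next
    case 3
    then have "j - ?m < length Bs" "i - ?m < j - ?m" using ij by auto
    then obtain l where "l < j - ?m" "Bs ! l \<subseteq> Bs ! (i - ?m) \<union> Bs ! (j - ?m)"
      "card (Bs ! l - Bs ! (j - ?m)) = 1"
      using assms(2) unfolding exchange_ordered_def by blast
    then show ?thesis using 3 ij by (intro exI[of _ "?m + l"]) (auto simp: nth_append)
  qed
qed

text \<open>The sets through a simplicial vertex \<open>v\<close> arise by adding \<open>v\<close>
  to the independent \<open>(k - 1)\<close>-sets of its non-neighbours. Induction orders these and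
  the sets avoiding \<open>v\<close>; the exchange at \<open>v\<close> links the two blocks.\<close>

theorem chordal_indep_exchange_ordered:
  assumes "finite V" "chordal_graph V E" and loop: "\<And>z. {z} \<notin> E"
  shows "\<exists>Ss. distinct Ss \<and> set Ss = {S. S \<subseteq> V \<and> indep S E \<and> card S = k} \<and> exchange_ordered Ss"
  using assms(1,2)
proof (induction "card V" arbitrary: V k rule: less_induct)
  case less
  have fin: "finite S" if "S \<subseteq> V" for S using that less.prems finite_subset by blast
  consider "k = 0" | "V = {}" "k \<noteq> 0" | l where "k = Suc l" "V \<noteq> {}" by (cases k) auto
  then show ?case
  proof cases
    case 1
    then have "{S. S \<subseteq> V \<and> indep S E \<and> card S = k} = set [{}]"
      using fin by (auto simp: indep_def)
    then show ?thesis by (intro exI[of _ "[{}]"]) (auto simp: exchange_ordered_def)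
  next
    case 2
    then show ?thesis by (intro exI[of _ "[]"]) (auto simp: exchange_ordered_def)
  next
    case 3
    then obtain v where v: "simplicial V E v"
      using chordal_simplicial_exists less.prems loop by blast
    then have vV: "v \<in> V" by (simp add: simplicial_def)
    let ?N = "non_nbrs V E v"
    have nn: "?N \<subseteq> V - {v}" by (auto simp: non_nbrs_def)
    obtain As where As: "distinct As" "set As = {S. S \<subseteq> ?N \<and> indep S E \<and> card S = l}"
      "exchange_ordered As"
      using less.hyps[of ?N l] card_non_nbrs_less[OF less.prems(1) vV] nn less.prems fin[of ?N]
        chordal_graph_subset[of V E ?N] by blast
    obtain Bs where Bs: "distinct Bs" "set Bs = {S. S \<subseteq> V - {v} \<and> indep S E \<and> card S = k}"
      "exchange_ordered Bs"
      using less.hyps[of "V - {v}" k] card_Diff1_less[OF less.prems(1) vV] less.prems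
        chordal_graph_subset[of V E "V - {v}"] by blast
    let ?As = "map (insert v) As"
    have vAs: "v \<notin> S" if "S \<in> set As" for S using that As nn by auto
    have setAs: "set ?As = {S. S \<subseteq> V \<and> v \<in> S \<and> indep S E \<and> card S = k}"
    proof (intro equalityI subsetI)
      fix S assume "S \<in> set ?As"
      then obtain T where T: "S = insert v T" "T \<subseteq> ?N" "indep T E" "card T = l"
        using As by auto
      moreover from this have "finite T" "v \<notin> T" using fin[of T] nn by auto
      ultimately show "S \<in> {S. S \<subseteq> V \<and> v \<in> S \<and> indep S E \<and> card S = k}"
        using indep_insert_non_nbrs[of T E V v] nn vV 3 by auto
    next
      fix S assume S: "S \<in> {S. S \<subseteq> V \<and> v \<in> S \<and> indep S E \<and> card S = k}"
      then have "S - {v} \<in> set As"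
        using As 3 fin[of S] by (auto simp: non_nbrs_def indep_def)
      moreover have "S = insert v (S - {v})" using S by blast
      ultimately show "S \<in> set ?As" by (metis image_eqI list.set_map)
    qed
    have "exchange_ordered (?As @ Bs)"
    proof (rule exchange_ordered_append)
      show "exchange_ordered ?As" using exchange_ordered_map_insert As(3) vAs .
      show "exchange_ordered Bs" by fact
      fix A B assume A: "A \<in> set ?As" and "B \<in> set Bs"
      then have B: "B \<subseteq> V" "v \<notin> B" "indep B E" "card B = k" using Bs by auto
      then obtain s where s: "s \<in> B" "B - {s} \<subseteq> ?N"
        using simplicial_exchange[OF v, of B] 3(1) by fastforce
      have "indep (B - {s}) E" using B by (auto simp: indep_def)
      \<comment> \<open>The partner is \<open>B\<close> with \<open>s\<close> exchanged for
        \<open>v\<close>: it lies in \<open>A \<union> B\<close> because \<open>v \<in> A\<close>,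
        and \<open>v\<close> is its only element outside \<open>B\<close>.\<close>
      then have "insert v (B - {s}) \<in> set ?As"
        using s B As 3 by auto
      moreover have "insert v (B - {s}) \<subseteq> A \<union> B" using A setAs by auto
      moreover have "insert v (B - {s}) - B = {v}" using B by blast
      ultimately show "\<exists>A'\<in>set ?As. A' \<subseteq> A \<union> B \<and> card (A' - B) = 1"
        by (metis card_1_singleton_iff One_nat_def)
    qed
    moreover have "inj_on (insert v) (set As)"
      using vAs by (intro inj_onI) (metis insert_ident)
    then have "distinct (?As @ Bs)"
      using As Bs by (auto simp: distinct_map)
    moreover have "set (?As @ Bs) = {S. S \<subseteq> V \<and> indep S E \<and> card S = k}"
      unfolding set_append setAs Bs(2) by blast
    ultimately show ?thesis by blast
  qed
qed

text \<open>In complements, \<open>Ss ! l \<subseteq> Ss ! i \<union> Ss ! j\<close> says that the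
  \<open>l\<close>-th facet contains the intersection of the \<open>i\<close>-th and
  \<open>j\<close>-th. The cardinality condition says that it meets the \<open>j\<close>-th in all
  but one vertex.\<close>

lemma exchange_ordered_shelling:
  assumes "finite V" "distinct Ss" "exchange_ordered Ss"
    and Ss: "set Ss = {S. S \<subseteq> V \<and> indep S E \<and> card S = k}"
  shows "shelling (total_cut_complex V E k) (map (\<lambda>S. V - S) Ss)"
  unfolding shelling_def
proof (intro conjI allI impI)
  let ?Fs = "map (\<lambda>S. V - S) Ss"
  have "inj_on (\<lambda>S. V - S) (set Ss)"
    using Ss by (intro inj_onI) blast
  then show "distinct ?Fs" using assms(2) by (simp add: distinct_map)
  show "set ?Fs = complex_facets (total_cut_complex V E k)"
    using Ss complex_facets_total_cut_complex[OF assms(1)] by auto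
  fix j assume j: "j < length ?Fs" "0 < j"
  let ?I = "(\<Union>i<j. Pow (?Fs ! i)) \<inter> Pow (?Fs ! j)"
  show "pure_of_dim ?I (face_dim (?Fs ! j) - 1)"
    unfolding pure_of_dim_def
  proof
    fix H assume H: "H \<in> complex_facets ?I"
    then obtain i where i: "i < j" "H \<subseteq> ?Fs ! i" "H \<subseteq> ?Fs ! j"
      by (auto simp: complex_facets_def)
    then obtain l where l: "l < j" "Ss ! l \<subseteq> Ss ! i \<union> Ss ! j" "card (Ss ! l - Ss ! j) = 1"
      using assms(3) j unfolding exchange_ordered_def length_map by blast
    have "Ss ! l \<in> set Ss" using l j by simp
    then have lV: "Ss ! l \<subseteq> V" using Ss by blast
    \<comment> \<open>This face contains \<open>H\<close>, so maximality of \<open>H\<close> forces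
      equality.\<close>
    have "?Fs ! l \<inter> ?Fs ! j \<in> ?I" using l by blast
    moreover have "H \<subseteq> ?Fs ! l \<inter> ?Fs ! j" using i l j by auto
    ultimately have "H = ?Fs ! l \<inter> ?Fs ! j"
      using H unfolding complex_facets_def by blast
    also have "\<dots> = ?Fs ! j - (Ss ! l - Ss ! j)" using l j by auto
    finally have H': "H = ?Fs ! j - (Ss ! l - Ss ! j)" .
    obtain a where a: "Ss ! l - Ss ! j = {a}" using l(3) card_1_singletonE by blast
    then have "a \<in> ?Fs ! j" using lV j by auto
    moreover have "finite (?Fs ! j)" using assms(1) j by simp
    ultimately have "card (?Fs ! j) = Suc (card H)"
      unfolding H' a by (metis card.remove)
    then show "face_dim H = face_dim (?Fs ! j) - 1" by (simp add: face_dim_def)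
  qed
qed

theorem theorem4p12:
  fixes V :: "'a set" and E :: "'a set set" and k :: nat
  assumes "finite V"
    and "E \<subseteq> [V]\<^bsup>2\<^esup>"
    and "chordal_graph V E"
    and "k \<ge> 2"
  shows "vertex_decomposable (total_cut_complex V E k) \<and> shellable (total_cut_complex V E k)"
proof
  \<comment> \<open>For \<open>x = y\<close> the term \<open>{x, y}\<close> collapses to a
    singleton, which is no edge because edges have two elements.\<close>
  have loop: "{z} \<notin> E" for z using assms(2) by (auto simp: nsets_def)
  show "vertex_decomposable (total_cut_complex V E k)"
    \<comment> \<open>With \<open>W = V\<close> the apex simplex has no vertices and the cone is the
      total cut complex itself.\<close>
    using vertex_decomposable_coned_cut_complex[of V V E k] assms loop
    by (simp add: coned_cut_complex_self)
  show "shellable (total_cut_complex V E k)"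
    using chordal_indep_exchange_ordered[OF assms(1,3) loop, of k]
      exchange_ordered_shelling[OF assms(1)] is_complex_total_cut_complex[OF assms(1)]
    unfolding shellable_def by blast
qed

end
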